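(* As $n\to\infty$, \[ f_{(0,1,1,0)}(n)\sim\sqrt{2n}\qquad\text{and}\qquad f_{(0,0,0,1)}(n)\sim\sqrt{2n}. \]
   Context: Write $[n]=\{1,2,\ldots,n\}$ and let $2^{[n]}$ be the collection of all subsets of $[n]$. For $\alpha=(\alpha_1,\ldots,\alpha_k)\in\mathbb{F}_2^k$, a collection $\mathcal{F}\subset 2^{[n]}$ satisfies $\alpha$-intersection pattern modulo $2$ if, for every $1\le i\le k$, $|F_1\cap\cdots\cap F_i|\equiv\alpha_i \pmod 2$ for all (pairwise) distinct $F_1,\ldots,F_i\in\mathcal{F}$. Let $f_\alpha(n)$ denote the maximum size of a family $\mathcal{F}\subset 2^{[n]}$ satisfying $\alpha$-intersection pattern modulo $2$. For functions $f,g$, write $f\sim g$ if $\lim_{n\to\infty} f(n)/g(n)=1$. *)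

theory Defs
  imports Complex_Main "HOL-Library.Z2" "HOL-Library.Landau_Symbols"
begin

text \<open>
  The type \<^typ>\<open>bit\<close> is the field with two elements, so \<^term>\<open>of_nat m = (a :: bit)\<close> says that
  \<open>m\<close> is congruent to \<open>a\<close> modulo 2. Pairwise distinct members \<open>F\<^sub>1, \<dots>, F\<^sub>i\<close> of a family
  are given as a subfamily \<open>\<G>\<close> with exactly \<open>i\<close> elements. Lists are indexed from 0, hence \<open>\<alpha> ! (i - 1)\<close>.
\<close>
definition intersection_pattern :: "bit list \<Rightarrow> nat set set \<Rightarrow> bool" where
  "intersection_pattern \<alpha> \<F> \<longleftrightarrow>
     (\<forall>i\<in>{1..length \<alpha>}. \<forall>\<G>\<subseteq>\<F>. card \<G> = i \<longrightarrow> of_nat (card (\<Inter>\<G>)) = \<alpha> ! (i - 1))"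

text \<open>The maximum is over a finite set, which is nonempty since the empty family qualifies vacuously.\<close>
definition max_pattern_size :: "bit list \<Rightarrow> nat \<Rightarrow> nat" where
  "max_pattern_size \<alpha> n = Max {card \<F> |\<F>. \<F> \<subseteq> Pow {1..n} \<and> intersection_pattern \<alpha> \<F>}"

end

theory Submission
  imports Defs "HOL-Library.FuncSet" "HOL-Real_Asymp.Real_Asymp"
begin

text \<open>
  Both patterns have the form \<open>(a, 1 + c, 1 + c, c)\<close> over the field with two elements, with \<open>c = 0\<close>
  or \<open>c = 1\<close>, and both extremal families have about \<open>\<surd>(2n)\<close> members because a family of \<open>m\<close> sets
  needs as many points as there are pairs of its members, up to an error linear in \<open>m\<close>.

  Upper bound. Consider the intersections \<open>A \<inter> B\<close> of the \<open>m choose 2\<close> pairs of members as vectors of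
  length \<open>n\<close> over the field with two elements. The inner product of two of them is the parity of an
  intersection of four, three or two members, hence it is prescribed by the pattern. The Gram matrix
  turns out to be \<open>I + N\<^sup>T N + c J\<close>, where \<open>N\<close> is the vertex-edge incidence matrix of the complete
  graph on the family and \<open>J\<close> is the all-ones matrix. As \<open>N\<close> has \<open>m\<close> rows and \<open>J\<close> has rank one, the
  Gram matrix has rank at least \<open>(m choose 2) - m - 1\<close>, and this rank is at most \<open>n\<close>. The rank
  argument is phrased as a count in \<open>pairs_le_of_pattern\<close>: a set of pairs can be recovered from
  \<open>n + m + 1\<close> bits.

  Lower bound. Exchange the roles of points and members: a point is the set of members that contain
  it, so a family with \<open>m\<close> members is a hypergraph on \<open>m\<close> vertices, and the pattern prescribes for
  every \<open>t \<le> 4\<close> the parity of the number of edges that contain \<open>t\<close> given vertices. If the edges are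
  the complements of all pairs, this number is \<open>(m - t) choose 2\<close>, which for \<open>m \<equiv> 1 (mod 4)\<close> and
  \<open>t = 1, 2, 3, 4\<close> has the parities \<open>0, 1, 1, 0\<close>. Adding the whole vertex set flips all four parities
  and adding the singletons flips the first one once more, which gives \<open>0, 0, 0, 1\<close>. Both
  hypergraphs have \<open>m\<^sup>2 / 2 + O(m)\<close> edges.
\<close>

section \<open>Upper bound\<close>

(* By default the simplifier turns sums of bits into bit operations, which hides the ring structure. *)
declare add_bit_eq_xor [simp del] mult_bit_eq_and [simp del]

lemma bit_add_self [simp]: "(b :: bit) + b = 0"
  by (cases b) simp_all

lemma card_UNIV_bit: "card (UNIV :: bit set) = 2"
proof -
  have UNIV_eq: "(UNIV :: bit set) = {0, 1}"
    using bit_not_zero_iff by blast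
  show ?thesis unfolding UNIV_eq by simp
qed

lemma finite_UNIV_bit: "finite (UNIV :: bit set)"
  using card_UNIV_bit by (metis card.infinite zero_neq_numeral)

text \<open>
  The Gram matrix of the pairwise intersections is \<open>I + N\<^sup>T N + c J\<close>: its entry depends only on the
  number \<open>4 - \<bar>e \<inter> e'\<bar>\<close> of members that are intersected, and \<open>\<bar>e \<inter> e'\<bar>\<close> is the corresponding entry
  of \<open>N\<^sup>T N\<close>.
\<close>
lemma gram_of_pattern:
  fixes \<F> :: "nat set set"
  assumes pattern: "intersection_pattern [a, 1 + c, 1 + c, c] \<F>"
    and e: "e \<subseteq> \<F>" "card e = 2" and e': "e' \<subseteq> \<F>" "card e' = 2"
  shows "of_nat (card (\<Inter>e \<inter> \<Inter>e')) = of_bool (e = e') + of_nat (card (e \<inter> e')) + c"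
proof -
  have fin: "finite e" "finite e'"
    using e e' by (auto intro: card_ge_0_finite)
  have sum: "card (e \<union> e') + card (e \<inter> e') = 4"
    using card_Un_Int[OF fin] e e' by simp
  have le: "card (e \<inter> e') \<le> 2"
    using card_mono[of e "e \<inter> e'"] fin e by auto
  have eq_iff: "e = e' \<longleftrightarrow> card (e \<inter> e') = 2"
    using card_subset_eq[of e "e \<inter> e'"] card_subset_eq[of e' "e \<inter> e'"] fin e e' by auto
  have "of_nat (card (\<Inter>(e \<union> e'))) = [a, 1 + c, 1 + c, c] ! (card (e \<union> e') - 1)"
  proof -
    have "card (e \<union> e') \<in> {1..length [a, 1 + c, 1 + c, c]}" "e \<union> e' \<subseteq> \<F>"
      using e e' sum le by auto
    then show ?thesis
      using pattern unfolding intersection_pattern_def by blast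
  qed
  also have "\<dots> = of_bool (e = e') + of_nat (card (e \<inter> e')) + c"
  proof -
    consider "card (e \<inter> e') = 0" "card (e \<union> e') = 4" | "card (e \<inter> e') = 1" "card (e \<union> e') = 3"
      | "card (e \<inter> e') = 2" "card (e \<union> e') = 2"
      using sum le by linarith
    then show ?thesis
      unfolding eq_iff by cases (simp_all add: numeral_eq_Suc)
  qed
  finally show ?thesis
    by (simp only: Inter_Un_distrib)
qed

text \<open>
  The Gram matrix differs from the identity only by the matrices \<open>N\<^sup>T N\<close> and \<open>c J\<close> of small rank.
  Hence a set \<open>E\<close> of pairs is determined by the sum of the vectors \<open>A \<inter> B\<close> over its pairs (\<open>card X\<close> bits),
  the parities of its vertex degrees, that is \<open>N E\<close> (\<open>card \<F>\<close> bits), and the parity of its size (one bit).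
  Comparing the number of sets of pairs with the number of possible values gives the bound.
\<close>
lemma pairs_le_of_pattern:
  fixes \<F> :: "nat set set"
  assumes X: "finite X" "\<F> \<subseteq> Pow X"
    and pattern: "intersection_pattern [a, 1 + c, 1 + c, c] \<F>"
  shows "card \<F> choose 2 \<le> card X + card \<F> + 1"
proof -
  let ?C = "(X \<rightarrow>\<^sub>E (UNIV :: bit set)) \<times> (\<F> \<rightarrow>\<^sub>E (UNIV :: bit set)) \<times> (UNIV :: bit set)"
  define P where "P = {e. e \<subseteq> \<F> \<and> card e = 2}"
  define v where "v E x = (\<Sum>e\<in>E. of_bool (x \<in> \<Inter>e) :: bit)" for E and x :: nat
  define d where "d E A = (\<Sum>e\<in>E. of_bool (A \<in> e) :: bit)" for E and A :: "nat set"
  define code where "code E = (restrict (v E) X, restrict (d E) \<F>, of_nat (card E) :: bit)" for E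
  have fin: "finite \<F>"
    using X finite_subset by auto
  have finP: "finite P"
    unfolding P_def using fin by simp
  have decode: "of_bool (e \<in> E) = (\<Sum>x\<in>\<Inter>e. v E x) + (\<Sum>A\<in>e. d E A) + of_nat (card E) * c"
    if E: "E \<subseteq> P" and e: "e \<in> P" for E e
  proof -
    have "finite E"
      using E finP finite_subset by blast
    have "e \<noteq> {}"
      using e by (auto simp: P_def)
    then have "\<Inter>e \<subseteq> X"
      using e X by (auto simp: P_def)
    then have fe: "finite (\<Inter>e)" "finite e"
      using X e by (auto simp: P_def intro: finite_subset card_ge_0_finite)
    have "(\<Sum>x\<in>\<Inter>e. v E x) = (\<Sum>e'\<in>E. \<Sum>x\<in>\<Inter>e. of_bool (x \<in> \<Inter>e'))"
      unfolding v_def by (rule sum.swap)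
    also have "\<dots> = (\<Sum>e'\<in>E. of_nat (card (\<Inter>e \<inter> \<Inter>e')))"
      using fe by (intro sum.cong refl) (simp add: sum_of_bool_eq Int_def)
    finally have v: "(\<Sum>x\<in>\<Inter>e. v E x) = (\<Sum>e'\<in>E. of_nat (card (\<Inter>e \<inter> \<Inter>e')))" .
    have "(\<Sum>A\<in>e. d E A) = (\<Sum>e'\<in>E. \<Sum>A\<in>e. of_bool (A \<in> e'))"
      unfolding d_def by (rule sum.swap)
    also have "\<dots> = (\<Sum>e'\<in>E. of_nat (card (e \<inter> e')))"
      using fe by (intro sum.cong refl) (simp add: sum_of_bool_eq Int_def)
    finally have d: "(\<Sum>A\<in>e. d E A) = (\<Sum>e'\<in>E. of_nat (card (e \<inter> e')))" .
    have "(\<Sum>x\<in>\<Inter>e. v E x) + (\<Sum>A\<in>e. d E A) + of_nat (card E) * c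
        = (\<Sum>e'\<in>E. of_nat (card (\<Inter>e \<inter> \<Inter>e')) + of_nat (card (e \<inter> e')) + c)"
      by (simp add: v d sum.distrib)
    also have "\<dots> = (\<Sum>e'\<in>E. of_bool (e = e'))"
    proof (rule sum.cong[OF refl])
      fix e' assume "e' \<in> E"
      then have "of_nat (card (\<Inter>e \<inter> \<Inter>e')) = of_bool (e = e') + of_nat (card (e \<inter> e')) + c"
        using E e by (intro gram_of_pattern[OF pattern]) (auto simp: P_def)
      moreover have "(p + q + r) + q + r = p" for p q r :: bit
        by (cases p; cases q; cases r) simp_all
      ultimately show "of_nat (card (\<Inter>e \<inter> \<Inter>e')) + of_nat (card (e \<inter> e')) + c = of_bool (e = e')"
        by metis
    qed
    also have "\<dots> = of_bool (e \<in> E)"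
      using \<open>finite E\<close> by (simp add: of_bool_def)
    finally show ?thesis ..
  qed
  have "inj_on code (Pow P)"
  proof (rule inj_onI)
    fix E E' assume E: "E \<in> Pow P" "E' \<in> Pow P" and eq: "code E = code E'"
    have v: "v E x = v E' x" if "x \<in> X" for x
      using eq that unfolding code_def by (metis prod.inject restrict_apply')
    have d: "d E A = d E' A" if "A \<in> \<F>" for A
      using eq that unfolding code_def by (metis prod.inject restrict_apply')
    have "e \<in> E \<longleftrightarrow> e \<in> E'" if e: "e \<in> P" for e
    proof -
      have "e \<noteq> {}"
        using e by (auto simp: P_def)
      then have "\<Inter>e \<subseteq> X" "e \<subseteq> \<F>"
        using e X by (auto simp: P_def)
      then have "(\<Sum>x\<in>\<Inter>e. v E x) = (\<Sum>x\<in>\<Inter>e. v E' x)" "(\<Sum>A\<in>e. d E A) = (\<Sum>A\<in>e. d E' A)"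
        by (auto intro!: sum.cong v d)
      moreover have "(of_nat (card E) :: bit) = of_nat (card E')"
        using eq unfolding code_def by blast
      ultimately have "(of_bool (e \<in> E) :: bit) = of_bool (e \<in> E')"
        using decode[of E e] decode[of E' e] E e by auto
      then show ?thesis
        by (simp split: if_splits add: of_bool_def)
    qed
    then show "E = E'"
      using E by blast
  qed
  moreover have "code ` Pow P \<subseteq> ?C"
    by (auto simp: code_def)
  moreover have "finite ?C"
    using X fin by (intro finite_cartesian_product finite_PiE) (simp_all add: finite_UNIV_bit)
  ultimately have "card (Pow P) \<le> card ?C"
    by (meson card_inj_on_le)
  also have "\<dots> = 2 ^ (card X + card \<F> + 1)"
    using X fin by (simp add: card_cartesian_product card_funcsetE card_UNIV_bit power_add)
  finally have "(2::nat) ^ card P \<le> 2 ^ (card X + card \<F> + 1)"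
    using finP by (simp only: card_Pow)
  then have "card P \<le> card X + card \<F> + 1"
    by (rule power_le_imp_le_exp[rotated]) simp
  then show ?thesis
    using n_subsets[OF fin, of 2] by (simp add: P_def)
qed

lemma finite_pattern_sizes: "finite {card \<F> |\<F>. \<F> \<subseteq> Pow {1..n} \<and> intersection_pattern \<alpha> \<F>}"
  by (rule finite_subset[of _ "card ` Pow (Pow {1..n})"]) auto

lemma max_pattern_size_pairs_le:
  "max_pattern_size [a, 1 + c, 1 + c, c] n choose 2 \<le> n + max_pattern_size [a, 1 + c, 1 + c, c] n + 1"
proof -
  let ?S = "{card \<F> |\<F>. \<F> \<subseteq> Pow {1..n} \<and> intersection_pattern [a, 1 + c, 1 + c, c] \<F>}"
  have "intersection_pattern [a, 1 + c, 1 + c, c] {}"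
    by (auto simp: intersection_pattern_def)
  then have "?S \<noteq> {}"
    by blast
  then have "max_pattern_size [a, 1 + c, 1 + c, c] n \<in> ?S"
    unfolding max_pattern_size_def using finite_pattern_sizes by (rule Max_in[rotated])
  then obtain \<F> where "\<F> \<subseteq> Pow {1..n}" "intersection_pattern [a, 1 + c, 1 + c, c] \<F>"
    and "max_pattern_size [a, 1 + c, 1 + c, c] n = card \<F>"
    by auto
  then show ?thesis
    using pairs_le_of_pattern[of "{1..n}" \<F> a c] by simp
qed

section \<open>Lower bound\<close>

text \<open>
  Point-member duality: the vertices of the hypergraph become the members of the family, its edges
  become the points, and the edges containing a set \<open>T\<close> of vertices become the intersection of the
  members in \<open>T\<close>. Two vertices have to be separated by an edge in order to give distinct members.
\<close>
lemma card_le_max_pattern_size: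
  fixes V :: "'v set"
  assumes V: "finite V" and B: "\<B> \<subseteq> Pow V" "card \<B> \<le> n"
    and separating: "\<And>i j. i \<in> V \<Longrightarrow> j \<in> V \<Longrightarrow> i \<noteq> j \<Longrightarrow> \<exists>S\<in>\<B>. i \<in> S \<and> j \<notin> S"
    and degree: "\<And>T. T \<subseteq> V \<Longrightarrow> 1 \<le> card T \<Longrightarrow> card T \<le> length \<alpha> \<Longrightarrow>
      of_nat (card {S \<in> \<B>. T \<subseteq> S}) = \<alpha> ! (card T - 1)"
  shows "card V \<le> max_pattern_size \<alpha> n"
proof -
  have "finite \<B>"
    using B V finite_subset by auto
  then obtain g where g: "g ` \<B> \<subseteq> {1..n}" "inj_on g \<B>"
    using card_le_inj[of \<B> "{1..n}"] B by auto
  define A where "A i = g ` {S \<in> \<B>. i \<in> S}" for i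
  have mem_A: "g S \<in> A i \<longleftrightarrow> i \<in> S" if "S \<in> \<B>" for S i
    using g that by (auto simp: A_def inj_on_def)
  have "inj_on A V"
    using separating mem_A by (metis inj_onI)
  have "intersection_pattern \<alpha> (A ` V)"
    unfolding intersection_pattern_def
  proof (intro ballI allI impI)
    fix k \<G> assume k: "k \<in> {1..length \<alpha>}" and G: "\<G> \<subseteq> A ` V" "card \<G> = k"
    then obtain T where T: "T \<subseteq> V" "\<G> = A ` T"
      using subset_imageE by metis
    have cardT: "card T = k"
      using G T \<open>inj_on A V\<close> card_image inj_on_subset by metis
    then have "T \<noteq> {}"
      using k by auto
    have "\<Inter>\<G> = g ` {S \<in> \<B>. T \<subseteq> S}"
    proof
      show "\<Inter>\<G> \<subseteq> g ` {S \<in> \<B>. T \<subseteq> S}"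
      proof
        fix x assume x: "x \<in> \<Inter>\<G>"
        then obtain S where S: "S \<in> \<B>" "x = g S"
          using T \<open>T \<noteq> {}\<close> by (auto simp: A_def)
        then have "T \<subseteq> S"
          using x T mem_A by auto
        then show "x \<in> g ` {S \<in> \<B>. T \<subseteq> S}"
          using S by blast
      qed
      show "g ` {S \<in> \<B>. T \<subseteq> S} \<subseteq> \<Inter>\<G>"
        using T by (auto simp: A_def)
    qed
    moreover have "inj_on g {S \<in> \<B>. T \<subseteq> S}"
      using g by (auto intro: inj_on_subset)
    ultimately have "card (\<Inter>\<G>) = card {S \<in> \<B>. T \<subseteq> S}"
      by (simp add: card_image)
    then show "of_nat (card (\<Inter>\<G>)) = \<alpha> ! (k - 1)"
      using degree[of T] T cardT k by simp
  qed
  moreover have "A ` V \<subseteq> Pow {1..n}"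
    using g by (auto simp: A_def)
  moreover have "card V = card (A ` V)"
    using \<open>inj_on A V\<close> by (simp add: card_image)
  ultimately show ?thesis
    unfolding max_pattern_size_def by (intro Max_ge finite_pattern_sizes) blast
qed

definition copairs :: "'v set \<Rightarrow> 'v set set" where
  "copairs V = {S. S \<subseteq> V \<and> card (V - S) = 2}"

lemma card_copairs_containing:
  assumes "finite V" "T \<subseteq> V"
  shows "card {S \<in> copairs V. T \<subseteq> S} = (card V - card T) choose 2"
proof -
  have complement: "V - (V - U) = U" if "U \<subseteq> V - T" for U
    using that by blast
  have "bij_betw (\<lambda>S. V - S) {S \<in> copairs V. T \<subseteq> S} {U. U \<subseteq> V - T \<and> card U = 2}"
    by (rule bij_betwI[where g = "\<lambda>U. V - U"])
      (use assms in \<open>auto simp: copairs_def double_diff complement\<close>)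
  then have "card {S \<in> copairs V. T \<subseteq> S} = card {U. U \<subseteq> V - T \<and> card U = 2}"
    by (rule bij_betw_same_card)
  then show ?thesis
    using assms by (simp add: n_subsets card_Diff_subset finite_subset)
qed

lemma card_copairs: "finite V \<Longrightarrow> card (copairs V) = card V choose 2"
  using card_copairs_containing[of V "{}"] by simp

lemma copairs_separating:
  assumes V: "finite V" "3 \<le> card V" and ij: "i \<in> V" "j \<in> V" "i \<noteq> j"
  shows "\<exists>S\<in>copairs V. i \<in> S \<and> j \<notin> S"
proof -
  have "\<not> V \<subseteq> {i, j}"
    using card_mono[of "{i, j}" V] V ij by auto
  then obtain k where k: "k \<in> V" "k \<noteq> i" "k \<noteq> j"
    by blast
  then have "V - (V - {j, k}) = {j, k}"
    using ij by auto
  then have "V - {j, k} \<in> copairs V"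
    using k by (simp add: copairs_def)
  moreover have "i \<in> V - {j, k}" "j \<notin> V - {j, k}"
    using k ij by auto
  ultimately show ?thesis
    by (intro bexI conjI)
qed

text \<open>
  \<open>r choose 2\<close> is even exactly for \<open>r \<equiv> 0, 1 (mod 4)\<close>. For \<open>m \<equiv> 1 (mod 4)\<close> the four numbers \<open>m - t\<close>
  have the residues \<open>0, 3, 2, 1\<close>.
\<close>
lemma parity_choose_two_pattern:
  assumes m: "m mod 4 = 1" and t: "1 \<le> t" "t \<le> 4" "t \<le> m"
  shows "(of_nat ((m - t) choose 2) :: bit) = [0, 1, 1, 0] ! (t - 1)"
proof -
  obtain k where k: "m = 4 * k + 1"
    using m by (metis mult_div_mod_eq)
  have choose: "r choose 2 = s" if "r * (r - 1) = 2 * s" for r s :: nat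
    using that by (simp add: choose_two)
  have of_nat_bit: "(of_nat s :: bit) = of_bool (odd s)" for s
    by (induction s) auto
  consider "t = 1" | "t = 2" | "t = 3" | "t = 4"
    using t by linarith
  then show ?thesis
  proof cases
    case 1
    have "(m - t) choose 2 = 2 * k * (4 * k - 1)"
      by (rule choose) (simp add: k 1)
    then show ?thesis by (simp add: 1 of_nat_bit)
  next
    case 2
    with t k obtain l where l: "k = Suc l"
      by (cases k) auto
    have "(m - t) choose 2 = (4 * l + 3) * (2 * l + 1)"
      by (rule choose) (simp add: k l 2 algebra_simps)
    then show ?thesis by (simp add: 2 of_nat_bit)
  next
    case 3
    with t k obtain l where l: "k = Suc l"
      by (cases k) auto
    have "(m - t) choose 2 = (2 * l + 1) * (4 * l + 1)"
      by (rule choose) (simp add: k l 3 algebra_simps)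
    then show ?thesis by (simp add: 3 of_nat_bit)
  next
    case 4
    with t k obtain l where l: "k = Suc l"
      by (cases k) auto
    have "(m - t) choose 2 = (4 * l + 1) * (2 * l)"
      by (rule choose) (simp add: k l 4 algebra_simps)
    then show ?thesis by (simp add: 4 of_nat_bit)
  qed
qed

lemma max_pattern_size_0110_ge:
  assumes m: "m mod 4 = 1" "5 \<le> m" and n: "(m choose 2) + m + 1 \<le> n"
  shows "m \<le> max_pattern_size [0, 1, 1, 0] n"
proof -
  let ?V = "{..<m}"
  have "card ?V \<le> max_pattern_size [0, 1, 1, 0] n"
  proof (rule card_le_max_pattern_size[where \<B> = "copairs ?V"])
    show "copairs ?V \<subseteq> Pow ?V"
      by (auto simp: copairs_def)
    show "card (copairs ?V) \<le> n"
      using n by (simp add: card_copairs)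
    show "\<exists>S\<in>copairs ?V. i \<in> S \<and> j \<notin> S" if "i \<in> ?V" "j \<in> ?V" "i \<noteq> j" for i j
      using that m by (intro copairs_separating) auto
    show "of_nat (card {S \<in> copairs ?V. T \<subseteq> S}) = ([0, 1, 1, 0] :: bit list) ! (card T - 1)"
      if T: "T \<subseteq> ?V" "1 \<le> card T" "card T \<le> length ([0, 1, 1, 0] :: bit list)" for T
      using parity_choose_two_pattern[of m "card T"] T m card_mono[of ?V T]
      by (simp add: card_copairs_containing)
  qed simp
  then show ?thesis by simp
qed

text \<open>
  The three kinds of edges have \<open>m - 2\<close>, \<open>m\<close> and \<open>1\<close> vertices. These sizes differ since \<open>m \<ge> 5\<close>, so
  the three degrees of a set \<open>T\<close> add up. The whole vertex set always contributes one and the singletons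
  contribute one exactly if \<open>T\<close> is a singleton, which turns \<open>0, 1, 1, 0\<close> into \<open>0, 0, 0, 1\<close>.
\<close>
lemma max_pattern_size_0001_ge:
  assumes m: "m mod 4 = 1" "5 \<le> m" and n: "(m choose 2) + m + 1 \<le> n"
  shows "m \<le> max_pattern_size [0, 0, 0, 1] n"
proof -
  define V where "V = {..<m}"
  have V: "finite V" "card V = m"
    by (simp_all add: V_def)
  define singles where "singles = (\<lambda>i. {i}) ` V"
  let ?B = "copairs V \<union> insert V singles"
  have fin: "finite (copairs V)" "finite singles"
    using V by (simp_all add: singles_def copairs_def)
  have V_not_single: "V \<notin> singles"
  proof
    assume "V \<in> singles"
    then have "card V = 1"
      unfolding singles_def by (metis card_1_singleton_iff imageE One_nat_def)
    then show False
      using m V by simp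
  qed
  have single_not_copair: "S \<notin> copairs V" if "S \<in> singles" for S
  proof -
    obtain i where "i \<in> V" "S = {i}"
      using \<open>S \<in> singles\<close> by (auto simp: singles_def)
    then have "card (V - S) = m - 1"
      using V by simp
    then have "card (V - S) \<noteq> 2"
      using m(2) by linarith
    then show ?thesis
      by (simp add: copairs_def)
  qed
  have V_not_copair: "V \<notin> copairs V"
    by (simp add: copairs_def)
  have "card V \<le> max_pattern_size [0, 0, 0, 1] n"
  proof (rule card_le_max_pattern_size[where \<B> = ?B])
    show "?B \<subseteq> Pow V"
      by (auto simp: copairs_def singles_def)
    have "card (insert V singles) \<le> m + 1"
      using fin V V_not_single by (simp add: singles_def card_image)
    then show "card ?B \<le> n"
      using n card_Un_le[of "copairs V" "insert V singles"] V by (simp add: card_copairs)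
    show "\<exists>S\<in>?B. i \<in> S \<and> j \<notin> S" if "i \<in> V" "j \<in> V" "i \<noteq> j" for i j
      using copairs_separating[of V i j] that V m(2) by auto
    show "of_nat (card {S \<in> ?B. T \<subseteq> S}) = ([0, 0, 0, 1] :: bit list) ! (card T - 1)"
      if T: "T \<subseteq> V" "1 \<le> card T" "card T \<le> length ([0, 0, 0, 1] :: bit list)" for T
    proof -
      have T_le: "card T \<le> 4"
        using T by simp
      have singles_containing: "card {S \<in> singles. T \<subseteq> S} = (if card T = 1 then 1 else 0)"
      proof (cases "card T = 1")
        case True
        then obtain i where "T = {i}"
          by (auto simp: card_1_singleton_iff)
        then have "{S \<in> singles. T \<subseteq> S} = {{i}}"
          using T by (auto simp: singles_def)
        then show ?thesis
          using True by simp
      next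
        case False
        have "\<not> T \<subseteq> {i}" for i
          using False T card_mono[of "{i}" T] by auto
        then have "{S \<in> singles. T \<subseteq> S} = {}"
          by (auto simp: singles_def)
        then show ?thesis
          using False by (metis card.empty)
      qed
      have "{S \<in> ?B. T \<subseteq> S} = {S \<in> copairs V. T \<subseteq> S} \<union> insert V {S \<in> singles. T \<subseteq> S}"
        using T by auto
      also have "card \<dots> = card {S \<in> copairs V. T \<subseteq> S} + card (insert V {S \<in> singles. T \<subseteq> S})"
        using fin single_not_copair V_not_copair by (intro card_Un_disjoint) auto
      also have "\<dots> = ((m - card T) choose 2) + (if card T = 1 then 1 else 0) + 1"
        using fin V V_not_single T by (simp add: card_copairs_containing singles_containing)
      finally have "(of_nat (card {S \<in> ?B. T \<subseteq> S}) :: bit)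
          = of_nat ((m - card T) choose 2) + (if card T = 1 then 1 else 0) + 1"
        by simp
      also have "of_nat ((m - card T) choose 2) = ([0, 1, 1, 0] :: bit list) ! (card T - 1)"
        using T V card_mono[of V T] by (intro parity_choose_two_pattern[OF m(1)]) auto
      finally have parity: "(of_nat (card {S \<in> ?B. T \<subseteq> S}) :: bit)
          = [0, 1, 1, 0] ! (card T - 1) + (if card T = 1 then 1 else 0) + 1" .
      consider "card T = 1" | "card T = 2" | "card T = 3" | "card T = 4"
        using T(2) T_le by linarith
      then show ?thesis
        unfolding parity by cases (simp_all add: numeral_eq_Suc)
    qed
  qed (use V in simp)
  then show ?thesis using V by simp
qed

section \<open>Asymptotics\<close>

text \<open>
  The two bounds pin the size down to \<open>\<surd>(2n) + O(1)\<close>: consecutive admissible values of \<open>m\<close> differ by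
  four only, and \<open>m choose 2\<close> is \<open>m\<^sup>2 / 2\<close> up to a linear term.
\<close>
lemma asymp_equiv_sqrt_of_choose_two_bounds:
  fixes h :: "nat \<Rightarrow> nat"
  assumes upper: "\<And>n. h n choose 2 \<le> n + h n + 1"
    and lower: "\<And>m n. m mod 4 = 1 \<Longrightarrow> 5 \<le> m \<Longrightarrow> (m choose 2) + m + 1 \<le> n \<Longrightarrow> m \<le> h n"
  shows "(\<lambda>n. real (h n)) \<sim>[at_top] (\<lambda>n. sqrt (2 * real n))"
proof (rule asymp_equiv_sandwich_real)
  show "(\<lambda>n. sqrt (2 * real n) - 6) \<sim>[at_top] (\<lambda>n. sqrt (2 * real n))"
    by real_asymp
  show "(\<lambda>n. sqrt (2 * real n) + 4) \<sim>[at_top] (\<lambda>n. sqrt (2 * real n))"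
    by real_asymp
  have choose: "real (m choose 2) = real m * (real m - 1) / 2" for m
    by (cases m) (simp_all add: choose_two real_of_nat_div algebra_simps)
  show "\<forall>\<^sub>F n in at_top. real (h n) \<in> {sqrt (2 * real n) - 6..sqrt (2 * real n) + 4}"
  proof (rule eventually_mono[OF eventually_ge_at_top[of 72]])
    fix n :: nat assume n: "72 \<le> n"
    define s where "s = sqrt (2 * real n)"
    have s2: "s\<^sup>2 = 2 * real n"
      by (simp add: s_def)
    have "12 \<le> s"
      unfolding s_def using n by (intro real_le_rsqrt) simp
    have "real (h n choose 2) \<le> real (n + h n + 1)"
      using upper of_nat_le_iff by blast
    then have "real (h n) * (real (h n) - 1) \<le> s\<^sup>2 + 2 * real (h n) + 2"
      unfolding choose s2 by simp
    then have "(real (h n) - 3 / 2)\<^sup>2 \<le> (s + 5 / 2)\<^sup>2"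
      using \<open>12 \<le> s\<close> by (simp add: power2_eq_square algebra_simps)
    then have le: "real (h n) \<le> s + 4"
      using \<open>12 \<le> s\<close> power2_le_imp_le[of "real (h n) - 3 / 2" "s + 5 / 2"] by simp
    define q where "q = nat \<lfloor>s\<rfloor>"
    have q: "real q \<le> s" "s < real q + 1" "12 \<le> q"
      using \<open>12 \<le> s\<close> unfolding q_def by linarith+
    (* The largest number m \<equiv> 1 (mod 4) with m \<le> q - 2; the gap of 2 absorbs the linear terms. *)
    define m where "m = 4 * ((q - 3) div 4) + 1"
    have m: "m mod 4 = 1" "5 \<le> m" "m + 2 \<le> q" "q \<le> m + 5"
    proof -
      have "4 * ((q - 3) div 4) + (q - 3) mod 4 = q - 3" "(q - 3) mod 4 < 4"
        by simp_all
      then show "5 \<le> m" "m + 2 \<le> q" "q \<le> m + 5"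
        using q(3) unfolding m_def by linarith+
    qed (simp add: m_def)
    have "real m * (real m - 1) + 2 * real m + 2 \<le> s\<^sup>2"
    proof -
      have "real m * (real m + 1) + 2 \<le> (real m + 2)\<^sup>2"
        by (simp add: power2_eq_square algebra_simps)
      also have "\<dots> \<le> s\<^sup>2"
        using m q by (intro power_mono) linarith+
      finally show ?thesis
        by (simp add: algebra_simps)
    qed
    then have "real ((m choose 2) + m + 1) \<le> real n"
      unfolding s2 by (simp add: choose)
    then have "(m choose 2) + m + 1 \<le> n"
      using of_nat_le_iff by blast
    then have "m \<le> h n"
      using m lower by blast
    then have "s - 6 \<le> real (h n)"
      using m q by linarith
    then show "real (h n) \<in> {sqrt (2 * real n) - 6..sqrt (2 * real n) + 4}"
      using le by (simp add: s_def)
  qed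
qed

theorem theorem2:
  shows "(\<lambda>n. real (max_pattern_size [0, 1, 1, 0] n)) \<sim>[at_top] (\<lambda>n. sqrt (2 * real n))
       \<and> (\<lambda>n. real (max_pattern_size [0, 0, 0, 1] n)) \<sim>[at_top] (\<lambda>n. sqrt (2 * real n))"
proof
  show "(\<lambda>n. real (max_pattern_size [0, 1, 1, 0] n)) \<sim>[at_top] (\<lambda>n. sqrt (2 * real n))"
    using max_pattern_size_pairs_le[of 0 0]
    by (intro asymp_equiv_sqrt_of_choose_two_bounds max_pattern_size_0110_ge) simp_all
  show "(\<lambda>n. real (max_pattern_size [0, 0, 0, 1] n)) \<sim>[at_top] (\<lambda>n. sqrt (2 * real n))"
    using max_pattern_size_pairs_le[of 0 1]
    by (intro asymp_equiv_sqrt_of_choose_two_bounds max_pattern_size_0001_ge) simp_all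
qed

end
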